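(* Let $I\subseteq\mathbb{R}[\mathbf{x}]=\mathbb{R}[x_1,\ldots,x_n]$ be any ideal. Then $$\mathrm{TH}_1(I)=\bigcap_{F\in I,\ F\text{ convex quadric}}\mathrm{conv}(\mathcal{V}_{\mathbb{R}}(F))=\bigcap_{F\in I,\ F\text{ convex quadric}}\{\mathbf{x}\in\mathbb{R}^n : F(\mathbf{x})\le0\}.$$
   Context: A convex quadric is a polynomial of degree two of the form $F(\mathbf{x})=\mathbf{x}^tA\mathbf{x}+\mathbf{b}^t\mathbf{x}+c$ with $A\neq0$ an $n\times n$ (symmetric) positive semidefinite matrix, $\mathbf{b}\in\mathbb{R}^n$, $c\in\mathbb{R}$. $\mathcal{V}_{\mathbb{R}}(F)=\{\mathbf{x}\in\mathbb{R}^n : F(\mathbf{x})=0\}$. A polynomial is linear if it has degree at most $1$; $f$ is $1$-sos mod $I$ if there are linear polynomials $h_1,\ldots,h_t$ with $f-\sum_j h_j^2\in I$. The first theta body is $\mathrm{TH}_1(I):=\{\mathbf{x}\in\mathbb{R}^n : f(\mathbf{x})\ge0\text{ for every linear } f\text{ that is }1\text{-sos mod } I\}$. An empty intersection of subsets of $\mathbb{R}^n$ is $\mathbb{R}^n$. *)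

theory Defs
  imports "HOL-Analysis.Analysis" "HOL-Library.Poly_Mapping"
begin

text \<open>
  The ring \<open>\<real>[x\<^sub>1,\<dots>,x\<^sub>n]\<close> is rendered as the monoid algebra of finitely supported functions from
  exponent vectors to the reals. The variables are indexed by a finite type \<open>'n\<close>, with
  \<open>n = CARD('n) \<ge> 1\<close> arbitrary; addition and multiplication are those of the class
  \<^class>\<open>comm_ring_1\<close>.
\<close>

type_synonym 'n rpoly = "('n \<Rightarrow>\<^sub>0 nat) \<Rightarrow>\<^sub>0 real"

definition pconst :: "real \<Rightarrow> 'n rpoly" where
  "pconst c = Poly_Mapping.single 0 c"

definition pvar :: "'n \<Rightarrow> 'n rpoly" where
  "pvar i = Poly_Mapping.single (Poly_Mapping.single i 1) 1"

definition peval :: "'n::finite rpoly \<Rightarrow> real^'n \<Rightarrow> real" where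
  "peval f x = (\<Sum>m\<in>Poly_Mapping.keys f.
     Poly_Mapping.lookup f m * (\<Prod>i\<in>UNIV. (x $ i) ^ Poly_Mapping.lookup m i))"

text \<open>The zero polynomial gets total degree \<open>0\<close>, so that it counts as linear.\<close>

definition total_degree :: "'n::finite rpoly \<Rightarrow> nat" where
  "total_degree f =
     Max (insert 0 ((\<lambda>m. \<Sum>i\<in>UNIV. Poly_Mapping.lookup m i) ` Poly_Mapping.keys f))"

definition linear_poly :: "'n::finite rpoly \<Rightarrow> bool" where
  "linear_poly f \<longleftrightarrow> total_degree f \<le> 1"

text \<open>An ideal is a submodule of the ring, regarded as a module over itself.\<close>

definition poly_ideal :: "'n rpoly set \<Rightarrow> bool" where
  "poly_ideal I \<longleftrightarrow> module.subspace (*) I"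

definition real_variety :: "'n::finite rpoly \<Rightarrow> (real^'n) set" where
  "real_variety f = {x. peval f x = 0}"

definition one_sos_mod :: "'n::finite rpoly set \<Rightarrow> 'n rpoly \<Rightarrow> bool" where
  "one_sos_mod I f \<longleftrightarrow>
     (\<exists>hs. (\<forall>h\<in>set hs. linear_poly h) \<and> f - (\<Sum>h\<leftarrow>hs. h\<^sup>2) \<in> I)"

definition theta_body_1 :: "'n::finite rpoly set \<Rightarrow> (real^'n) set" where
  "theta_body_1 I = {x. \<forall>f. linear_poly f \<and> one_sos_mod I f \<longrightarrow> peval f x \<ge> 0}"

definition psd_matrix :: "real^'n^'n::finite \<Rightarrow> bool" where
  "psd_matrix A \<longleftrightarrow> transpose A = A \<and> (\<forall>v. v \<bullet> (A *v v) \<ge> 0)"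

text \<open>The polynomial (as opposed to the function) \<open>x\<^sup>t A x + b\<^sup>t x + c\<close>.\<close>

definition quadric_poly :: "real^'n^'n \<Rightarrow> real^'n \<Rightarrow> real \<Rightarrow> 'n::finite rpoly" where
  "quadric_poly A b c =
     (\<Sum>i\<in>UNIV. \<Sum>j\<in>UNIV. pconst (A $ i $ j) * pvar i * pvar j)
     + (\<Sum>i\<in>UNIV. pconst (b $ i) * pvar i) + pconst c"

definition convex_quadric :: "'n::finite rpoly \<Rightarrow> bool" where
  "convex_quadric F \<longleftrightarrow> total_degree F = 2 \<and>
     (\<exists>A b c. A \<noteq> 0 \<and> psd_matrix A \<and> F = quadric_poly A b c)"

end

theory Submission
  imports Defs
begin

text \<open>
  A convex quadric \<open>F\<close> that is negative at \<open>p\<close> vanishes on both sides of \<open>p\<close> on any line through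
  \<open>p\<close> along which its quadratic part is positive, so \<open>conv (V(F)) = {F \<le> 0}\<close> for each single \<open>F\<close>.

  If \<open>f - \<Sum> h\<^sub>j\<^sup>2 \<in> I\<close> with \<open>f\<close> linear, then \<open>F = \<Sum> h\<^sub>j\<^sup>2 - f\<close> is either linear or a convex quadric in
  \<open>I\<close>, and \<open>F(p) \<le> 0\<close> gives \<open>f(p) \<ge> 0\<close>; a linear \<open>F \<in> I\<close> is handled through its square.
  Conversely, let \<open>F \<in> I\<close> have quadratic part \<open>\<Sum> (l\<^sub>j \<bullet> x)\<^sup>2\<close>. Then
  \<open>f = \<Sum> (l\<^sub>j \<bullet> x - l\<^sub>j \<bullet> p)\<^sup>2 - F\<close> is linear, 1-sos modulo \<open>I\<close>, and takes the value \<open>-F(p)\<close> at \<open>p\<close>.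
\<close>

section \<open>Coefficients, degree and evaluation of quadrics\<close>

text \<open>For distinct \<open>i\<close> and \<open>j\<close> the monomial \<open>x_i x_j\<close>
  arises from both orders of the pair and collects \<open>A $ i $ j\<close> and
  \<open>A $ j $ i\<close>; hence sums over all indices rather than single entries.\<close>

lemma lookup_quadric_poly:
  "Poly_Mapping.lookup (quadric_poly A b c) m =
    (\<Sum>i\<in>UNIV. \<Sum>j\<in>UNIV. if Poly_Mapping.single i 1 + Poly_Mapping.single j 1 = m then A $ i $ j else 0)
    + (\<Sum>i\<in>UNIV. if Poly_Mapping.single i 1 = m then b $ i else 0)
    + (if m = 0 then c else 0)"
  by (auto simp: quadric_poly_def pconst_def pvar_def mult_single lookup_add lookup_sum
      lookup_single when_def cong: if_cong intro!: sum.cong)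

lemma total_degree_le_iff:
  "total_degree f \<le> k \<longleftrightarrow>
    (\<forall>m. Poly_Mapping.lookup f m \<noteq> 0 \<longrightarrow> (\<Sum>i\<in>UNIV. Poly_Mapping.lookup m i) \<le> k)"
  unfolding total_degree_def by (subst Max_le_iff) (auto simp: in_keys_iff)

lemma sum_lookup_single [simp]:
  "(\<Sum>k\<in>UNIV. Poly_Mapping.lookup (Poly_Mapping.single (i::'n::finite) (c::nat)) k) = c"
  by (simp add: lookup_single when_def)

lemma sum_lookup_add:
  "(\<Sum>k\<in>UNIV. Poly_Mapping.lookup (m + m' :: 'n::finite \<Rightarrow>\<^sub>0 nat) k) =
    (\<Sum>k\<in>UNIV. Poly_Mapping.lookup m k) + (\<Sum>k\<in>UNIV. Poly_Mapping.lookup m' k)"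
  by (simp add: lookup_add sum.distrib)

lemma total_degree_quadric_poly_le: "total_degree (quadric_poly A b c) \<le> 2"
  unfolding total_degree_le_iff
proof (intro allI impI)
  fix m :: "'a \<Rightarrow>\<^sub>0 nat"
  assume nz: "Poly_Mapping.lookup (quadric_poly A b c) m \<noteq> 0"
  have "(\<exists>i j. Poly_Mapping.single i 1 + Poly_Mapping.single j 1 = m) \<or>
      (\<exists>i. Poly_Mapping.single i 1 = m) \<or> m = 0"
  proof (rule ccontr)
    assume "\<not> ?thesis"
    with nz show False by (simp add: lookup_quadric_poly)
  qed
  then show "(\<Sum>i\<in>UNIV. Poly_Mapping.lookup m i) \<le> 2"
    by (auto simp del: single_add simp: sum_lookup_add)
qed

lemma linear_poly_quadric_poly_zero: "linear_poly (quadric_poly 0 b c)"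
  unfolding linear_poly_def total_degree_le_iff
proof (intro allI impI)
  fix m :: "'a \<Rightarrow>\<^sub>0 nat"
  assume nz: "Poly_Mapping.lookup (quadric_poly 0 b c) m \<noteq> 0"
  have "(\<exists>i. Poly_Mapping.single i 1 = m) \<or> m = 0"
  proof (rule ccontr)
    assume "\<not> ?thesis"
    with nz show False by (simp add: lookup_quadric_poly cong: if_cong)
  qed
  then show "(\<Sum>i\<in>UNIV. Poly_Mapping.lookup m i) \<le> 1"
    by auto
qed

text \<open>The only exponent vectors of total degree at most 1 are 0 and the unit vectors, so the
  coefficients there determine \<open>f\<close>.\<close>

lemma linear_poly_obtain:
  fixes f :: "'n::finite rpoly"
  assumes "linear_poly f"
  obtains b c where "f = quadric_poly 0 b c"
proof
  have inj: "Poly_Mapping.single i (1::nat) = Poly_Mapping.single j 1 \<longleftrightarrow> i = j" for i j :: 'n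
    by (metis lookup_single_eq lookup_single_not_eq zero_neq_one)
  have ne: "Poly_Mapping.single i (1::nat) \<noteq> 0" for i :: 'n
    by (metis lookup_single_eq lookup_zero zero_neq_one)
  define b :: "real^'n" where "b = (\<chi> i. Poly_Mapping.lookup f (Poly_Mapping.single i 1))"
  define c where "c = Poly_Mapping.lookup f 0"
  show "f = quadric_poly 0 b c"
  proof (rule poly_mapping_eqI)
    fix m :: "'n \<Rightarrow>\<^sub>0 nat"
    have "m = 0 \<or> (\<exists>i. m = Poly_Mapping.single i 1)" if "(\<Sum>i\<in>UNIV. Poly_Mapping.lookup m i) \<le> 1"
    proof (rule disjCI)
      assume "\<nexists>i. m = Poly_Mapping.single i 1"
      show "m = 0"
      proof (rule ccontr)
        assume "m \<noteq> 0"
        then obtain i where i: "Poly_Mapping.lookup m i \<noteq> 0"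
          by (metis lookup_zero poly_mapping_eqI)
        \<comment> \<open>The total is at most 1 and the entry at \<open>i\<close> is a positive
          natural number, so it takes up the whole total.\<close>
        have s: "(\<Sum>k\<in>UNIV. Poly_Mapping.lookup m k) =
            Poly_Mapping.lookup m i + (\<Sum>k\<in>UNIV - {i}. Poly_Mapping.lookup m k)"
          by (intro sum.remove) auto
        with i that have "Poly_Mapping.lookup m i = 1" "(\<Sum>k\<in>UNIV - {i}. Poly_Mapping.lookup m k) = 0"
          by linarith+
        then have "m = Poly_Mapping.single i 1"
          by (intro poly_mapping_eqI) (auto simp: lookup_single when_def)
        with \<open>\<nexists>i. m = Poly_Mapping.single i 1\<close> show False by blast
      qed
    qed
    moreover have "(\<Sum>i\<in>UNIV. Poly_Mapping.lookup m i) \<le> 1" if "Poly_Mapping.lookup f m \<noteq> 0"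
      using assms that by (simp add: linear_poly_def total_degree_le_iff)
    ultimately consider "m = 0" | i where "m = Poly_Mapping.single i 1"
      | "Poly_Mapping.lookup f m = 0" "m \<noteq> 0" "\<forall>i. Poly_Mapping.single i 1 \<noteq> m"
      by metis
    then show "Poly_Mapping.lookup f m = Poly_Mapping.lookup (quadric_poly 0 b c) m"
      by cases (use ne inj in \<open>simp_all add: lookup_quadric_poly b_def c_def cong: if_cong\<close>)
  qed
qed

section \<open>Sums and squares of quadrics\<close>

lemma quadric_poly_add:
  "quadric_poly A b c + quadric_poly A' b' c' = quadric_poly (A + A') (b + b') (c + c')"
proof (rule poly_mapping_eqI)
  have if_add: "(if P then x + y else 0) = (if P then x else 0) + (if P then y else 0)"
    for P and x y :: real
    by simp
  show "Poly_Mapping.lookup (quadric_poly A b c + quadric_poly A' b' c') m =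
    Poly_Mapping.lookup (quadric_poly (A + A') (b + b') (c + c')) m" for m
    unfolding lookup_quadric_poly lookup_add vector_add_component if_add sum.distrib by simp
qed

lemma quadric_poly_diff:
  "quadric_poly A b c - quadric_poly A' b' c' = quadric_poly (A - A') (b - b') (c - c')"
  by (simp add: diff_eq_eq quadric_poly_add)

lemma quadric_poly_zero: "quadric_poly 0 0 0 = 0"
  by (simp add: quadric_poly_def pconst_def)

text \<open>The matrix \<open>b b^t\<close>, whose quadratic form is the square of the linear form
  \<open>b \<bullet> x\<close>.\<close>

definition outer :: "real^'n \<Rightarrow> real^'n^'n::finite" where
  "outer b = (\<chi> i j. b $ i * b $ j)"

lemma inner_outer: "v \<bullet> (outer b *v v) = (b \<bullet> v)\<^sup>2"
  by (simp add: outer_def inner_vec_def matrix_vector_mult_def power2_eq_square sum_product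
      sum_distrib_left mult_ac)

lemma psd_outer: "psd_matrix (outer b)"
  by (auto simp: psd_matrix_def inner_outer) (auto simp: outer_def transpose_def vec_eq_iff)

text \<open>An identity of polynomials, not only of their values, because membership in the ideal
  concerns polynomials.\<close>

lemma quadric_poly_zero_square:
  fixes b :: "real^'n::finite"
  shows "(quadric_poly 0 b c)\<^sup>2 = quadric_poly (outer b) ((2 * c) *\<^sub>R b) (c\<^sup>2)"
proof -
  have c: "pconst x * pconst y = (pconst (x * y) :: 'n rpoly)" for x y
    by (simp add: pconst_def mult_single)
  have c0: "pconst 0 = (0 :: 'n rpoly)"
    by (simp add: pconst_def)
  have c2: "pconst 2 = (2 :: 'n rpoly)"
    by (simp only: pconst_def one_add_one[symmetric] single_add single_one)
  define S where "S = (\<Sum>i\<in>UNIV. pconst (b $ i) * pvar i)"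
  have "S * S = (\<Sum>i\<in>UNIV. \<Sum>j\<in>UNIV. pconst (b $ i * b $ j) * pvar i * pvar j)"
    unfolding S_def sum_product c[symmetric] by (simp only: mult_ac)
  moreover have "(\<Sum>i\<in>UNIV. pconst (2 * c * b $ i) * pvar i) = 2 * pconst c * S"
    unfolding S_def sum_distrib_left c[symmetric] c2 by (simp only: mult_ac)
  moreover have "(quadric_poly 0 b c)\<^sup>2 = S * S + 2 * pconst c * S + pconst (c\<^sup>2)"
  proof -
    have "quadric_poly 0 b c = S + pconst c"
      by (simp add: quadric_poly_def S_def c0)
    then show ?thesis
      by (simp only: power2_eq_square c[symmetric]) (simp add: algebra_simps)
  qed
  ultimately show ?thesis
    by (simp add: quadric_poly_def[of "outer b" "(2 * c) *\<^sub>R b"]) (simp add: outer_def)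
qed

section \<open>Evaluation of polynomials\<close>

text \<open>Cancellation can shrink the support of a sum; summing over a common larger set of
  monomials lets evaluations be added termwise.\<close>

lemma peval_superset:
  assumes "finite M" "Poly_Mapping.keys f \<subseteq> M"
  shows "peval f x =
    (\<Sum>m\<in>M. Poly_Mapping.lookup f m * (\<Prod>i\<in>UNIV. (x $ i) ^ Poly_Mapping.lookup m i))"
  unfolding peval_def using assms by (intro sum.mono_neutral_left) (auto simp: in_keys_iff)

lemma peval_add: "peval (f + g) x = peval f x + peval g x"
proof -
  let ?M = "Poly_Mapping.keys f \<union> Poly_Mapping.keys g"
  have "Poly_Mapping.keys (f + g) \<subseteq> ?M"
    by (rule Poly_Mapping.keys_add)
  then show ?thesis
    by (simp add: peval_superset[of ?M] lookup_add algebra_simps sum.distrib)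
qed

lemma peval_zero [simp]: "peval 0 x = 0"
  by (simp add: peval_def)

lemma peval_diff: "peval (f - g) x = peval f x - peval g x"
  by (metis add_diff_cancel_right' diff_add_cancel peval_add)

lemma peval_sum: "peval (\<Sum>i\<in>S. f i) x = (\<Sum>i\<in>S. peval (f i) x)"
  by (induction S rule: infinite_finite_induct) (simp_all add: peval_add)

lemma peval_single:
  "peval (Poly_Mapping.single m a) x = a * (\<Prod>i\<in>UNIV. (x $ i) ^ Poly_Mapping.lookup m i)"
  by (simp add: peval_superset[of "{m}"])

lemma prod_power_lookup_single:
  fixes x :: "real^'n::finite"
  shows "(\<Prod>k\<in>UNIV. (x $ k) ^ Poly_Mapping.lookup (Poly_Mapping.single i (Suc 0)) k) = x $ i"
proof -
  have "(x $ k) ^ Poly_Mapping.lookup (Poly_Mapping.single i (Suc 0)) k = (if k = i then x $ k else 1)" for k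
    by (auto simp: lookup_single when_def)
  then show ?thesis by simp
qed

lemma peval_quadric_poly: "peval (quadric_poly A b c) x = x \<bullet> (A *v x) + b \<bullet> x + c"
proof -
  have "peval (pconst a * pvar i * pvar j) x = a * x $ i * x $ j" for a i j
    by (simp add: pconst_def pvar_def mult_single peval_single lookup_add power_add prod.distrib
        prod_power_lookup_single)
  moreover have "peval (pconst a * pvar i) x = a * x $ i" for a i
    by (simp add: pconst_def pvar_def mult_single peval_single prod_power_lookup_single)
  moreover have "peval (pconst c) x = c"
    by (simp add: pconst_def peval_single)
  ultimately have "peval (quadric_poly A b c) x =
      (\<Sum>i\<in>UNIV. \<Sum>j\<in>UNIV. A $ i $ j * x $ i * x $ j) + (\<Sum>i\<in>UNIV. b $ i * x $ i) + c"
    by (simp only: quadric_poly_def peval_add peval_sum)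
  then show ?thesis
    by (simp add: inner_vec_def matrix_vector_mult_def sum_distrib_left mult_ac)
qed

section \<open>Positive semidefinite matrices\<close>

lemma psd_matrix_symmetric: "psd_matrix A \<Longrightarrow> A $ i $ j = A $ j $ i"
  unfolding psd_matrix_def by (metis transpose_def vec_lambda_beta)

lemma inner_symmetric:
  assumes "psd_matrix A"
  shows "v \<bullet> (A *v w) = w \<bullet> (A *v v)"
  using assms unfolding psd_matrix_def by (metis dot_lmul_matrix inner_commute transpose_matrix_vector)

lemma quadratic_form_line:
  assumes "psd_matrix A"
  shows "(v + t *\<^sub>R w) \<bullet> (A *v (v + t *\<^sub>R w)) =
    v \<bullet> (A *v v) + 2 * t * (v \<bullet> (A *v w)) + t\<^sup>2 * (w \<bullet> (A *v w))"
  using inner_symmetric[OF assms, of w v]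
  by (simp add: matrix_vector_right_distrib matrix_vector_mult_scaleR inner_add_left inner_add_right
      power2_eq_square algebra_simps)

lemma inner_axis_axis_matrix: "axis i 1 \<bullet> (A *v axis j (1::real)) = A $ i $ j"
  by (simp add: inner_axis' matrix_vector_mul_component inner_axis)

lemma psd_matrix_diag_nonneg: "psd_matrix A \<Longrightarrow> A $ i $ i \<ge> 0"
  unfolding psd_matrix_def by (metis inner_axis_axis_matrix)

text \<open>On the line \<open>e_j + t e_i\<close> the form is affine in \<open>t\<close> with slope
  \<open>2 * A $ j $ i\<close>; it stays nonnegative for all \<open>t\<close> only if the slope is
  zero.\<close>

lemma psd_matrix_diag_zero:
  assumes "psd_matrix A" "A $ i $ i = 0"
  shows "A $ i $ j = 0"
proof (rule ccontr)
  assume nz: "A $ i $ j \<noteq> 0"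
  \<comment> \<open>Solves \<open>A $ j $ j + 2 * t * A $ j $ i = -1\<close>.\<close>
  define t where "t = - (A $ j $ j + 1) / (2 * A $ j $ i)"
  have "0 \<le> (axis j 1 + t *\<^sub>R axis i 1) \<bullet> (A *v (axis j 1 + t *\<^sub>R axis i 1))"
    using assms(1) by (simp add: psd_matrix_def)
  also have "\<dots> = A $ j $ j + 2 * t * A $ j $ i"
    unfolding quadratic_form_line[OF assms(1)] inner_axis_axis_matrix using assms(2) by simp
  also have "\<dots> = -1"
    using nz psd_matrix_symmetric[OF assms(1), of i j] by (simp add: t_def field_simps)
  finally show False by simp
qed

text \<open>If the diagonal vanished, every row would vanish too. The index serves as a Cholesky
  pivot and as a direction of strict convexity.\<close>

lemma psd_matrix_nonzero_diag:
  assumes "psd_matrix A" "A \<noteq> 0"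
  obtains i where "A $ i $ i > 0"
proof -
  have "\<exists>i. A $ i $ i \<noteq> 0"
    using psd_matrix_diag_zero[OF assms(1)] assms(2) by (metis vec_eq_iff zero_index)
  then show thesis
    using that psd_matrix_diag_nonneg[OF assms(1)] by (metis less_eq_real_def)
qed

lemma matrix_vector_axis: "(A *v axis i (1::real)) $ j = A $ j $ i"
  by (simp add: matrix_vector_mul_component inner_axis)

text \<open>
  One Cholesky step per induction step: subtracting \<open>(A e\<^sub>i)(A e\<^sub>i)\<^sup>t / A\<^sub>i\<^sub>i\<close> keeps the matrix positive
  semidefinite and clears the \<open>i\<close>-th diagonal entry without filling in a zero one.
\<close>

lemma psd_matrix_sum_outer:
  assumes "psd_matrix A"
  shows "\<exists>ls. A = (\<Sum>l\<leftarrow>ls. outer l)"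
  using assms
proof (induction "card {i. A $ i $ i \<noteq> 0}" arbitrary: A rule: less_induct)
  case less
  show ?case
  proof (cases "A = 0")
    case True
    then have "A = (\<Sum>l\<leftarrow>[]. outer l)" by simp
    then show ?thesis by blast
  next
    case False
    then obtain i where i: "A $ i $ i > 0"
      using psd_matrix_nonzero_diag[OF less.prems] by blast
    define l where "l = (1 / sqrt (A $ i $ i)) *\<^sub>R (A *v axis i 1)"
    have l: "l $ j = A $ j $ i / sqrt (A $ i $ i)" for j
      by (simp add: l_def matrix_vector_axis)
    define B where "B = A - outer l"
    have B: "B $ j $ k = A $ j $ k - A $ j $ i * A $ k $ i / A $ i $ i" for j k
      using i by (simp add: B_def outer_def l real_sqrt_mult_self)
    have "psd_matrix B"
      unfolding psd_matrix_def
    proof (intro conjI allI)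
      show "transpose B = B"
        using psd_matrix_symmetric[OF less.prems] by (simp add: transpose_def vec_eq_iff B mult_ac)
      fix v
      define s where "s = v \<bullet> (A *v axis i 1)"
      \<comment> \<open>The minimiser of the form of \<open>A\<close> on the line
        \<open>v + t e_i\<close>; the minimum is exactly the value of the form of \<open>B\<close>
        at \<open>v\<close>.\<close>
      define t where "t = - s / A $ i $ i"
      have "v \<bullet> (B *v v) = v \<bullet> (A *v v) - (l \<bullet> v)\<^sup>2"
        by (simp add: B_def matrix_vector_mult_diff_rdistrib inner_diff_right inner_outer)
      also have "(l \<bullet> v)\<^sup>2 = s\<^sup>2 / A $ i $ i"
        using i by (simp add: l_def s_def power_divide inner_commute)
      also have "v \<bullet> (A *v v) - s\<^sup>2 / A $ i $ i =
          (v + t *\<^sub>R axis i 1) \<bullet> (A *v (v + t *\<^sub>R axis i 1))"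
        unfolding quadratic_form_line[OF less.prems] inner_axis_axis_matrix s_def[symmetric]
        using i by (simp add: t_def field_simps power2_eq_square)
      also have "\<dots> \<ge> 0"
        using less.prems by (simp add: psd_matrix_def)
      finally show "v \<bullet> (B *v v) \<ge> 0" .
    qed
    moreover have "card {j. B $ j $ j \<noteq> 0} < card {j. A $ j $ j \<noteq> 0}"
    proof (rule psubset_card_mono)
      have "B $ i $ i = 0"
        using i by (simp add: B)
      moreover have "B $ j $ j = 0" if "A $ j $ j = 0" for j
        using that psd_matrix_diag_zero[OF less.prems that] by (simp add: B)
      ultimately show "{j. B $ j $ j \<noteq> 0} \<subset> {j. A $ j $ j \<noteq> 0}"
        using i by (metis (mono_tags, lifting) mem_Collect_eq order_less_irrefl psubsetI subsetI)
    qed simp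
    ultimately obtain ls where "B = (\<Sum>l\<leftarrow>ls. outer l)"
      using less.hyps by blast
    then have "A = (\<Sum>l\<leftarrow>l # ls. outer l)"
      by (simp add: B_def algebra_simps)
    then show ?thesis by blast
  qed
qed

lemma psd_matrix_add: "psd_matrix A \<Longrightarrow> psd_matrix B \<Longrightarrow> psd_matrix (A + B)"
  by (auto simp: psd_matrix_def matrix_vector_mult_add_rdistrib inner_add_right transpose_def vec_eq_iff)

lemma psd_matrix_zero: "psd_matrix 0"
  by (simp add: psd_matrix_def transpose_def vec_eq_iff)

section \<open>Convex quadrics\<close>

text \<open>Only the index pair \<open>(i, i)\<close> produces \<open>x_i^2\<close>, so with
  \<open>A $ i $ i > 0\<close> this monomial survives and the degree is exactly 2.\<close>

lemma convex_quadric_quadric_poly: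
  assumes "psd_matrix A" "A \<noteq> 0"
  shows "convex_quadric (quadric_poly A b c)"
proof -
  obtain i where i: "A $ i $ i > 0"
    using assms by (rule psd_matrix_nonzero_diag)
  let ?s = "\<lambda>i. Poly_Mapping.single i (1::nat)"
  let ?m = "?s i + ?s i"
  have "?s j + ?s k = ?m \<longleftrightarrow> j = i \<and> k = i" for j k
  proof
    assume eq: "?s j + ?s k = ?m"
    have "Poly_Mapping.lookup (?s j + ?s k) i = 2"
      unfolding eq by (simp add: lookup_add)
    then show "j = i \<and> k = i"
      by (auto simp: lookup_add lookup_single when_def split: if_splits)
  qed auto
  moreover have "?s j \<noteq> ?m" for j
    using sum_lookup_add[of "?s i" "?s i"] by (metis one_add_one one_eq_numeral_iff semiring_norm(85) sum_lookup_single)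
  moreover have "?m \<noteq> 0"
    by (metis lookup_add lookup_single_eq lookup_zero add_is_0 zero_neq_one)
  moreover have "(\<Sum>j\<in>UNIV. \<Sum>k\<in>UNIV. if j = i \<and> k = i then A $ j $ k else 0) = A $ i $ i"
  proof -
    have "(\<Sum>k\<in>UNIV. if j = i \<and> k = i then A $ j $ k else 0) = (if j = i then A $ i $ i else 0)" for j
      by auto
    then show ?thesis by simp
  qed
  ultimately have "Poly_Mapping.lookup (quadric_poly A b c) ?m = A $ i $ i"
    unfolding lookup_quadric_poly by simp
  with i have "\<not> total_degree (quadric_poly A b c) \<le> 1"
    unfolding total_degree_le_iff by (metis sum_lookup_add sum_lookup_single less_irrefl
        nat_1_add_1 not_less one_less_numeral_iff semiring_norm(76))
  with total_degree_quadric_poly_le[of A b c] assms show ?thesis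
    unfolding convex_quadric_def by (metis One_nat_def Suc_1 le_Suc_eq)
qed

lemma peval_line:
  assumes "psd_matrix A"
  shows "peval (quadric_poly A b c) (p + t *\<^sub>R v) = peval (quadric_poly A b c) p
    + t * (2 * (p \<bullet> (A *v v)) + b \<bullet> v) + t\<^sup>2 * (v \<bullet> (A *v v))"
  unfolding peval_quadric_poly quadratic_form_line[OF assms]
  by (simp add: inner_add_right algebra_simps)

section \<open>Sublevel sets and convex hulls\<close>

text \<open>At \<open>u x + v y\<close> the value is the same combination of the values at
  \<open>x\<close> and \<open>y\<close>, minus \<open>u * v * Q\<close>, where
  \<open>Q \<ge> 0\<close> is the form at \<open>y - x\<close>.\<close>

lemma convex_sublevel_quadric_poly:
  assumes "psd_matrix A"
  shows "convex {x. peval (quadric_poly A b c) x \<le> 0}"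
proof (rule convexI)
  let ?g = "peval (quadric_poly A b c)"
  fix x y :: "real^'a" and u v :: real
  assume xy: "x \<in> {x. ?g x \<le> 0}" "y \<in> {x. ?g x \<le> 0}" and uv: "0 \<le> u" "0 \<le> v" "u + v = 1"
  define D where "D = 2 * (x \<bullet> (A *v (y - x))) + b \<bullet> (y - x)"
  define Q where "Q = (y - x) \<bullet> (A *v (y - x))"
  have line: "?g (x + t *\<^sub>R (y - x)) = ?g x + t * D + t\<^sup>2 * Q" for t
    unfolding peval_line[OF assms] D_def Q_def ..
  have y: "?g y = ?g x + D + Q"
    using line[of 1] by simp
  have u: "u = 1 - v"
    using uv by simp
  have "u *\<^sub>R x + v *\<^sub>R y = x + v *\<^sub>R (y - x)"
    unfolding u by (simp add: algebra_simps)
  then have "?g (u *\<^sub>R x + v *\<^sub>R y) = u * ?g x + v * ?g y - u * v * Q"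
    unfolding y u by (simp only: line) (simp add: power2_eq_square algebra_simps)
  also have "\<dots> \<le> 0"
    using xy uv assms
    by (smt (verit, best) Q_def mem_Collect_eq mult_nonneg_nonneg mult_nonneg_nonpos psd_matrix_def)
  finally show "u *\<^sub>R x + v *\<^sub>R y \<in> {x. ?g x \<le> 0}" by simp
qed

text \<open>Since \<open>Q * g < 0\<close>, the discriminant exceeds \<open>D\<^sup>2\<close>; its
  root \<open>r\<close> beats \<open>\<bar>D\<bar>\<close>, which fixes the signs of the two
  zeros.\<close>

lemma quadratic_roots_straddle:
  fixes g D Q :: real
  assumes "g < 0" "Q > 0"
  obtains s t where "s < 0" "0 < t" "g + s * D + s\<^sup>2 * Q = 0" "g + t * D + t\<^sup>2 * Q = 0"
proof -
  define r where "r = sqrt (D\<^sup>2 - 4 * Q * g)"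
  have pos: "4 * Q * g < 0"
    using assms by (simp add: mult_pos_neg)
  then have r2: "r\<^sup>2 = D\<^sup>2 - 4 * Q * g"
    unfolding r_def by (intro real_sqrt_pow2) (smt (verit) zero_le_power2)
  have "\<bar>D\<bar> < r"
    unfolding r_def by (rule real_less_rsqrt) (use pos in simp)
  then have "(- D - r) / (2 * Q) < 0" "0 < (- D + r) / (2 * Q)"
    using assms by (auto simp: field_simps)
  moreover have "g + (- D - r) / (2 * Q) * D + ((- D - r) / (2 * Q))\<^sup>2 * Q = (r\<^sup>2 - (D\<^sup>2 - 4 * Q * g)) / (4 * Q)"
    "g + (- D + r) / (2 * Q) * D + ((- D + r) / (2 * Q))\<^sup>2 * Q = (r\<^sup>2 - (D\<^sup>2 - 4 * Q * g)) / (4 * Q)"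
    using assms by (simp_all add: field_simps power2_eq_square)
  ultimately show thesis
    using that r2 by simp
qed

lemma convex_hull_real_variety:
  assumes "convex_quadric F"
  shows "convex hull (real_variety F) = {x. peval F x \<le> 0}"
proof -
  obtain A b c where A: "A \<noteq> 0" "psd_matrix A" and F: "F = quadric_poly A b c"
    using assms by (auto simp: convex_quadric_def)
  obtain i where i: "A $ i $ i > 0"
    using A by (metis psd_matrix_nonzero_diag)
  show ?thesis
  proof
    show "convex hull (real_variety F) \<subseteq> {x. peval F x \<le> 0}"
      using convex_sublevel_quadric_poly[OF A(2), of b c]
      by (intro hull_minimal) (auto simp: F real_variety_def)
    show "{x. peval F x \<le> 0} \<subseteq> convex hull (real_variety F)"
    proof
      fix p
      assume "p \<in> {x. peval F x \<le> 0}"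
      then consider "peval F p = 0" | "peval F p < 0" by fastforce
      then show "p \<in> convex hull (real_variety F)"
      proof cases
        case 1
        then show ?thesis by (simp add: hull_inc real_variety_def)
      next
        case 2
        define v where "v = axis i (1::real)"
        have Q: "v \<bullet> (A *v v) > 0"
          using i by (simp only: v_def inner_axis_axis_matrix)
        obtain s t where st: "s < 0" "0 < t"
          and "peval F p + s * (2 * (p \<bullet> (A *v v)) + b \<bullet> v) + s\<^sup>2 * (v \<bullet> (A *v v)) = 0"
            "peval F p + t * (2 * (p \<bullet> (A *v v)) + b \<bullet> v) + t\<^sup>2 * (v \<bullet> (A *v v)) = 0"
          using quadratic_roots_straddle[OF 2 Q] by blast
        then have "p + s *\<^sub>R v \<in> real_variety F" "p + t *\<^sub>R v \<in> real_variety F"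
          by (simp_all add: real_variety_def F peval_line[OF A(2)])
        \<comment> \<open>The weights are nonnegative as \<open>s < 0 < t\<close>, sum to 1, and
          make the \<open>v\<close> components cancel, leaving \<open>p\<close>.\<close>
        then have "(t / (t - s)) *\<^sub>R (p + s *\<^sub>R v) + (- s / (t - s)) *\<^sub>R (p + t *\<^sub>R v)
            \<in> convex hull (real_variety F)"
          using st by (intro convexD[OF convex_convex_hull] hull_inc)
            (auto simp: diff_divide_distrib[symmetric] divide_nonpos_pos)
        also have "(t / (t - s)) *\<^sub>R (p + s *\<^sub>R v) + (- s / (t - s)) *\<^sub>R (p + t *\<^sub>R v)
            = (t / (t - s) + - s / (t - s)) *\<^sub>R p"
          unfolding scaleR_add_left by (simp add: scaleR_add_right mult.commute)
        also have "\<dots> = p"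
        proof -
          have "t / (t - s) + - s / (t - s) = 1"
            using st by (simp add: diff_divide_distrib[symmetric])
          then show ?thesis by simp
        qed
        finally show ?thesis .
      qed
    qed
  qed
qed

section \<open>The first theta body\<close>

lemma module_rpoly: "module ((*) :: 'n rpoly \<Rightarrow> _)"
  by unfold_locales (auto simp: algebra_simps)

lemma poly_ideal_iff:
  "poly_ideal I \<longleftrightarrow> 0 \<in> I \<and> (\<forall>x\<in>I. \<forall>y\<in>I. x + y \<in> I) \<and> (\<forall>c. \<forall>x\<in>I. c * x \<in> I)"
  unfolding poly_ideal_def module.subspace_def[OF module_rpoly] ..

lemma poly_ideal_minus: "poly_ideal I \<Longrightarrow> f \<in> I \<Longrightarrow> - f \<in> I"
  by (metis mult_minus1 poly_ideal_iff)

text \<open>Each square of a linear polynomial contributes some \<open>outer l\<close> to the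
  quadratic part, and positive semidefinite matrices are closed under addition.\<close>

lemma sos_quadric_poly:
  assumes "\<forall>h\<in>set hs. linear_poly h"
  shows "\<exists>A b c. psd_matrix A \<and> (\<Sum>h\<leftarrow>hs. h\<^sup>2) = quadric_poly A b c
    \<and> (\<forall>p. peval (\<Sum>h\<leftarrow>hs. h\<^sup>2) p \<ge> 0)"
  using assms
proof (induction hs)
  case Nil
  show ?case
    using quadric_poly_zero psd_matrix_zero by (auto intro: exI[of _ 0])
next
  case (Cons h hs)
  then obtain A b c where IH: "psd_matrix A" "(\<Sum>h\<leftarrow>hs. h\<^sup>2) = quadric_poly A b c"
    "\<forall>p. peval (\<Sum>h\<leftarrow>hs. h\<^sup>2) p \<ge> 0"
    by auto
  obtain l d where h: "h = quadric_poly 0 l d"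
    using Cons.prems linear_poly_obtain by (metis list.set_intros(1))
  have "peval (h\<^sup>2) p = (l \<bullet> p + d)\<^sup>2" for p
    by (simp add: h quadric_poly_zero_square peval_quadric_poly inner_outer power2_sum)
  with IH have "\<forall>p. peval (\<Sum>h\<leftarrow>h # hs. h\<^sup>2) p \<ge> 0"
    by (simp add: peval_add)
  moreover have "(\<Sum>h\<leftarrow>h # hs. h\<^sup>2) = quadric_poly (outer l + A) ((2 * d) *\<^sub>R l + b) (d\<^sup>2 + c)"
    by (simp add: IH(2) h quadric_poly_zero_square quadric_poly_add)
  ultimately show ?case
    using psd_matrix_add[OF psd_outer IH(1)] by blast
qed

text \<open>Shifting each linear form by its value at \<open>p\<close> makes every square vanish at
  \<open>p\<close> and leaves the quadratic part unchanged.\<close>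

lemma sum_squares_centered:
  "\<exists>d e. (\<Sum>l\<leftarrow>ls. (quadric_poly 0 l (- (l \<bullet> p)))\<^sup>2) = quadric_poly (\<Sum>l\<leftarrow>ls. outer l) d e
    \<and> peval (\<Sum>l\<leftarrow>ls. (quadric_poly 0 l (- (l \<bullet> p)))\<^sup>2) p = 0"
proof (induction ls)
  case Nil
  show ?case
    using quadric_poly_zero by (auto intro: exI[of _ 0])
next
  case (Cons l ls)
  have "peval ((quadric_poly 0 l (- (l \<bullet> p)))\<^sup>2) p = 0"
    by (simp add: quadric_poly_zero_square peval_quadric_poly inner_outer) (simp add: power2_eq_square)
  with Cons show ?case
    by (auto simp: peval_add) (auto simp: quadric_poly_zero_square quadric_poly_add)
qed

section \<open>Linear polynomials in the ideal\<close>

lemma outer_eq_zero_iff: "outer b = 0 \<longleftrightarrow> b = 0"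
  by (auto simp: outer_def vec_eq_iff)

text \<open>Turns a nonzero constant of the ideal, whose square is no quadric, into a nonconstant
  linear member.\<close>

lemma pvar_times_constant: "pvar i * quadric_poly 0 0 c = quadric_poly 0 (c *\<^sub>R axis i 1) 0"
proof -
  have "pconst (c * axis i 1 $ j) * pvar j = (if j = i then pconst c * pvar i else 0)" for j
    by (simp add: axis_def pconst_def)
  then show ?thesis
    by (simp add: quadric_poly_def pconst_def[of 0] mult.commute)
qed

text \<open>For \<open>b \<noteq> 0\<close> the square is a convex quadric in \<open>I\<close>, and
  its value at \<open>p\<close> is both a square and at most 0.\<close>

lemma linear_vanishes:
  assumes I: "poly_ideal I"
    and p: "\<And>F. F \<in> I \<Longrightarrow> convex_quadric F \<Longrightarrow> peval F p \<le> 0"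
    and L: "quadric_poly 0 b c \<in> I"
  shows "peval (quadric_poly 0 b c) p = 0"
proof -
  have vanish: "peval (quadric_poly 0 b c) p = 0" if "b \<noteq> 0" "quadric_poly 0 b c \<in> I" for b c
  proof -
    have "(quadric_poly 0 b c)\<^sup>2 \<in> I"
      using I that(2) by (simp add: poly_ideal_iff power2_eq_square)
    then have "quadric_poly (outer b) ((2 * c) *\<^sub>R b) (c\<^sup>2) \<in> I"
      by (simp only: quadric_poly_zero_square)
    then have "peval (quadric_poly (outer b) ((2 * c) *\<^sub>R b) (c\<^sup>2)) p \<le> 0"
      using p convex_quadric_quadric_poly[OF psd_outer] that(1) outer_eq_zero_iff by blast
    then have "(b \<bullet> p + c)\<^sup>2 \<le> 0"
      by (simp add: peval_quadric_poly inner_outer power2_sum mult_ac)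
    then show ?thesis
      by (simp add: peval_quadric_poly)
  qed
  show ?thesis
  proof (cases "b = 0 \<and> c \<noteq> 0")
    case False
    then show ?thesis
      using vanish L by (cases "b = 0") (auto simp: quadric_poly_zero)
  next
    case True
    \<comment> \<open>With a nonzero constant \<open>c\<close>, both \<open>c x\<^sub>i\<close> and \<open>c x\<^sub>i + c\<close> lie in \<open>I\<close>, so no such \<open>p\<close> exists.\<close>
    fix i :: 'a
    have "quadric_poly 0 (c *\<^sub>R axis i 1) 0 \<in> I"
      using I L True by (metis poly_ideal_iff pvar_times_constant)
    moreover from this have "quadric_poly 0 (c *\<^sub>R axis i 1) c \<in> I"
      using I L True quadric_poly_add[of 0 "c *\<^sub>R axis i 1" 0 0 0 c]
      by (metis add_0 add.right_neutral poly_ideal_iff)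
    ultimately have "peval (quadric_poly 0 (c *\<^sub>R axis i 1) 0) p = 0"
      "peval (quadric_poly 0 (c *\<^sub>R axis i 1) c) p = 0"
      using True by (auto intro!: vanish simp: axis_eq_0_iff)
    then show ?thesis
      using True by (simp add: peval_quadric_poly)
  qed
qed

lemma theta_body_1_eq:
  assumes I: "poly_ideal I"
  shows "theta_body_1 I = (\<Inter>F\<in>{F \<in> I. convex_quadric F}. {x. peval F x \<le> 0})"
proof (intro equalityI subsetI)
  fix p
  assume p: "p \<in> theta_body_1 I"
  have "peval F p \<le> 0" if F: "F \<in> I" "convex_quadric F" for F
  proof -
    obtain A b c where A: "psd_matrix A" and Feq: "F = quadric_poly A b c"
      using F(2) by (auto simp: convex_quadric_def)
    obtain ls where ls: "A = (\<Sum>l\<leftarrow>ls. outer l)"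
      using psd_matrix_sum_outer[OF A] by blast
    define hs where "hs = map (\<lambda>l. quadric_poly 0 l (- (l \<bullet> p))) ls"
    define S where "S = (\<Sum>h\<leftarrow>hs. h\<^sup>2)"
    obtain d e where S: "S = quadric_poly A d e" "peval S p = 0"
      using sum_squares_centered[of p ls] by (auto simp: S_def hs_def ls o_def)
    \<comment> \<open>\<open>S\<close> and \<open>F\<close> share the matrix \<open>A\<close>, so
      the quadratic parts cancel.\<close>
    have "linear_poly (S - F)"
      by (simp add: S Feq quadric_poly_diff linear_poly_quadric_poly_zero)
    moreover have "one_sos_mod I (S - F)"
      unfolding one_sos_mod_def
    proof (intro exI conjI)
      show "\<forall>h\<in>set hs. linear_poly h"
        by (auto simp: hs_def linear_poly_quadric_poly_zero)
      show "S - F - (\<Sum>h\<leftarrow>hs. h\<^sup>2) \<in> I"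
        using poly_ideal_minus[OF I F(1)] by (simp add: S_def)
    qed
    ultimately have "peval (S - F) p \<ge> 0"
      using p by (simp add: theta_body_1_def)
    then show ?thesis
      using S(2) by (simp add: peval_diff)
  qed
  then show "p \<in> (\<Inter>F\<in>{F \<in> I. convex_quadric F}. {x. peval F x \<le> 0})"
    by blast
next
  fix p
  assume "p \<in> (\<Inter>F\<in>{F \<in> I. convex_quadric F}. {x. peval F x \<le> 0})"
  then have p: "peval F p \<le> 0" if "F \<in> I" "convex_quadric F" for F
    using that by blast
  have "peval f p \<ge> 0" if f: "linear_poly f" "one_sos_mod I f" for f
  proof -
    obtain hs where hs: "\<forall>h\<in>set hs. linear_poly h" "f - (\<Sum>h\<leftarrow>hs. h\<^sup>2) \<in> I"
      using f(2) by (auto simp: one_sos_mod_def)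
    define S where "S = (\<Sum>h\<leftarrow>hs. h\<^sup>2)"
    obtain A b c where A: "psd_matrix A" and S: "S = quadric_poly A b c" "peval S p \<ge> 0"
      using sos_quadric_poly[OF hs(1)] unfolding S_def by blast
    obtain b' c' where f': "f = quadric_poly 0 b' c'"
      using f(1) by (rule linear_poly_obtain)
    have in_I: "S - f \<in> I"
      using poly_ideal_minus[OF I hs(2)] by (simp add: S_def)
    have eq: "S - f = quadric_poly A (b - b') (c - c')"
      by (simp add: S f' quadric_poly_diff)
    have "peval (S - f) p \<le> 0"
    \<comment> \<open>Subtracting the linear \<open>f\<close> keeps the matrix \<open>A\<close>; if
      it is zero, \<open>S - f\<close> is linear and the hypothesis on convex quadrics does not
      apply to it directly.\<close>
    proof (cases "A = 0")
      case True
      then show ?thesis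
        using linear_vanishes[OF I p, of "b - b'" "c - c'"] in_I unfolding eq by simp
    next
      case False
      then show ?thesis
        using p[OF in_I] convex_quadric_quadric_poly[OF A] unfolding eq by blast
    qed
    then show ?thesis
      using S(2) by (simp add: peval_diff)
  qed
  then show "p \<in> theta_body_1 I"
    by (simp add: theta_body_1_def)
qed

text \<open>The two intersections agree member by member; if \<open>I\<close> contains no convex
  quadric, both are \<open>UNIV\<close>.\<close>

theorem theorem5p4:
  fixes I :: "'n::finite rpoly set"
  assumes "poly_ideal I"
  shows "theta_body_1 I = (\<Inter>F\<in>{F \<in> I. convex_quadric F}. convex hull (real_variety F))
    \<and> (\<Inter>F\<in>{F \<in> I. convex_quadric F}. convex hull (real_variety F))
        = (\<Inter>F\<in>{F \<in> I. convex_quadric F}. {x. peval F x \<le> 0})"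
  using theta_body_1_eq[OF assms] by (simp add: convex_hull_real_variety)

end
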